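(* Let $G$ be a $\lambda$-term-graph over $\Sigma^\lambda_{12}$, let $G'$ be an arbitrary term graph over $\Sigma^\lambda_{12}$, and suppose $h$ is a homomorphism from $G$ to $G'$. Then: (i) If $G$ is fully back-linked, then $G'$ is also a $\lambda$-term-graph over $\Sigma^\lambda_{12}$, and $G'$ is fully back-linked. (ii) If $G$ is eager-scope, then $G'$ is also a $\lambda$-term-graph over $\Sigma^\lambda_{12}$, and $G'$ is eager-scope.
   Context: Term graphs. Let $\Sigma$ be a set of function symbols, each with an arity $\mathrm{ar}$. A term graph over $\Sigma$ is a tuple $G=(V,\mathit{lab},\mathit{args},r)$, where: - $V$ is a (possibly infinite) set of vertices; - $\mathit{lab}:V\to\Sigma$ is the labelling; - $\mathit{args}:V\to V^*$ satisfies $|\mathit{args}(v)|=\mathrm{ar}(\mathit{lab}(v))$; - $r\in V$ is the root, and every vertex is reachable from $r$. For $k\in\mathbb N$ write $w\rightarrowtail_k w'$ if $w'$ is the $k$-th entry (counting from $0$) of $\mathit{args}(w)$. Write $w\rightarrowtail w'$ if $w\rightarrowtail_k w'$ for some $k$. Homomorphisms. A homomorphism from $G_1$ to $G_2$ is a map $h:V_1\to V_2$ such that: - $h(r_1)=r_2$; - $\mathit{lab}_2(h(v))=\mathit{lab}_1(v)$; - $\mathit{args}_2(h(v))=\bar h(\mathit{args}_1(v))$ for all $v$, where $\bar h$ applies $h$ letterwise to words. Words. For words over $V$: juxtaposition is concatenation, $\epsilon$ is the empty word, and $\le$ is the prefix order. Signature. $\Sigma^\lambda_{ij}=\{@,\lambda,0,S\}$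 with $\mathrm{ar}(@)=2$, $\mathrm{ar}(\lambda)=1$, $\mathrm{ar}(0)=i$, $\mathrm{ar}(S)=j$, for $i\in\{0,1\}$, $j\in\{1,2\}$. $V(f)$ denotes the set of vertices labelled $f$. Abstraction-prefix functions. For a term graph $G$ over $\Sigma^\lambda_{ij}$, a map $P:V\to V^*$ is a correct abstraction-prefix function if, for all vertices $w,w_0,w_1$ and $k\in\{0,1\}$: - $P(r)=\epsilon$; - if $\mathit{lab}(w)=\lambda$ and $w\rightarrowtail_0 w_0$, then $P(w_0)=P(w)w$; - if $\mathit{lab}(w)=@$ and $w\rightarrowtail_k w_k$, then $P(w_k)=P(w)$; - if $\mathit{lab}(w)=0$, then $P(w)\neq\epsilon$; - if $\mathit{lab}(w)=0$ and $w\rightarrowtail_0 w_0$, then $\mathit{lab}(w_0)=\lambda$ and $P(w_0)w_0=P(w)$; - if $\mathit{lab}(w)=S$ and $w\rightarrowtail_0 w_0$, then $P(w_0)v=P(w)$ for some vertex $v$; - if $\mathit{lab}(w)=S$ and $w\rightarrowtail_1 w_1$, then $\mathit{lab}(w_1)=\lambda$ and $P(w_1)w_1=P(w)$. A $\lambda$-term-graph over $\Sigma^\lambda_{ij}$ is a term graph over $\Sigma^\lambda_{ij}$ that admits a correct abstraction-prefix function. Such a function is then unique, and is called the abstraction-prefix function $P$ of $G$. Eager-scope. A $\lambda$-term-graph $G$ over $\Sigma^\lambda_{1j}$ is eager-scope if: for all $w,v\in V$ and $p\in V^*$ with $P(w)=pv$ and $\mathit{lab}(w)\ne S$, there exist $n\in\mathbb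 N$ and vertices $w=w_0\rightarrowtail w_1\rightarrowtail\cdots\rightarrowtail w_n\rightarrowtail_0 v$ with $\mathit{lab}(w_n)=0$ and $pv\le P(w_i)$ for all $1\le i\le n-1$. Fully back-linked. $G$ is fully back-linked if: for all $w,v\in V$, $p\in V^*$ with $P(w)=pv$, there exist $n$ and $w=w_0\rightarrowtail w_1\rightarrowtail\cdots\rightarrowtail w_n\rightarrowtail v$ with $pv\le P(w_i)$ for all $0\le i\le n$. *)

theory Defs
  imports Main "HOL-Library.FuncSet" "HOL-Library.Sublist"
begin

text \<open>The signature is the type \<open>'f\<close> of symbols together with an arity function. Vertices are
  the elements of an explicit carrier; \<open>lab\<close> and \<open>args\<close> are only meaningful on it.\<close>

record ('v, 'f) tgraph =
  verts :: "'v set"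
  lab :: "'v \<Rightarrow> 'f"
  args :: "'v \<Rightarrow> 'v list"
  root :: 'v

definition edge_at :: "('v, 'f) tgraph \<Rightarrow> nat \<Rightarrow> 'v \<Rightarrow> 'v \<Rightarrow> bool" where
  "edge_at G k w w' \<longleftrightarrow> w \<in> verts G \<and> w' \<in> verts G \<and> k < length (args G w) \<and> args G w ! k = w'"

definition edge :: "('v, 'f) tgraph \<Rightarrow> 'v \<Rightarrow> 'v \<Rightarrow> bool" where
  "edge G w w' \<longleftrightarrow> (\<exists>k. edge_at G k w w')"

definition term_graph :: "('f \<Rightarrow> nat) \<Rightarrow> ('v, 'f) tgraph \<Rightarrow> bool" where
  "term_graph ar G \<longleftrightarrow>
     args G \<in> verts G \<rightarrow> lists (verts G) \<and>
     (\<forall>v \<in> verts G. length (args G v) = ar (lab G v)) \<and>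
     root G \<in> verts G \<and>
     (\<forall>v \<in> verts G. (edge G)\<^sup>*\<^sup>* (root G) v)"

definition tg_hom :: "('v \<Rightarrow> 'w) \<Rightarrow> ('v, 'f) tgraph \<Rightarrow> ('w, 'f) tgraph \<Rightarrow> bool" where
  "tg_hom h G1 G2 \<longleftrightarrow>
     h \<in> verts G1 \<rightarrow> verts G2 \<and>
     h (root G1) = root G2 \<and>
     (\<forall>v \<in> verts G1. lab G2 (h v) = lab G1 v) \<and>
     (\<forall>v \<in> verts G1. args G2 (h v) = map h (args G1 v))"

datatype lam_sym = App | Lam | Zero | Succ

fun lam_ar :: "nat \<Rightarrow> nat \<Rightarrow> lam_sym \<Rightarrow> nat" where
  "lam_ar i j App = 2"
| "lam_ar i j Lam = 1"
| "lam_ar i j Zero = i"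
| "lam_ar i j Succ = j"

text \<open>Extensionality (value \<open>undefined\<close> off the carrier) makes \<open>P\<close> a function with domain
  exactly \<open>verts G\<close>, so that it can be unique.\<close>

definition correct_apf ::
  "('v, lam_sym) tgraph \<Rightarrow> ('v \<Rightarrow> 'v list) \<Rightarrow> bool" where
  "correct_apf G P \<longleftrightarrow>
     P \<in> verts G \<rightarrow>\<^sub>E lists (verts G) \<and>
     P (root G) = [] \<and>
     (\<forall>w \<in> verts G. \<forall>w0 \<in> verts G.
        lab G w = Lam \<and> edge_at G 0 w w0 \<longrightarrow> P w0 = P w @ [w]) \<and>
     (\<forall>w \<in> verts G. \<forall>k \<in> {0, 1}. \<forall>wk \<in> verts G.
        lab G w = App \<and> edge_at G k w wk \<longrightarrow> P wk = P w) \<and>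
     (\<forall>w \<in> verts G. lab G w = Zero \<longrightarrow> P w \<noteq> []) \<and>
     (\<forall>w \<in> verts G. \<forall>w0 \<in> verts G.
        lab G w = Zero \<and> edge_at G 0 w w0 \<longrightarrow> lab G w0 = Lam \<and> P w0 @ [w0] = P w) \<and>
     (\<forall>w \<in> verts G. \<forall>w0 \<in> verts G.
        lab G w = Succ \<and> edge_at G 0 w w0 \<longrightarrow> (\<exists>v \<in> verts G. P w0 @ [v] = P w)) \<and>
     (\<forall>w \<in> verts G. \<forall>w1 \<in> verts G.
        lab G w = Succ \<and> edge_at G 1 w w1 \<longrightarrow> lab G w1 = Lam \<and> P w1 @ [w1] = P w)"

text \<open>Intended for \<open>i \<in> {0, 1}\<close> and \<open>j \<in> {1, 2}\<close>.\<close>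

definition lambda_term_graph :: "nat \<Rightarrow> nat \<Rightarrow> ('v, lam_sym) tgraph \<Rightarrow> bool" where
  "lambda_term_graph i j G \<longleftrightarrow> term_graph (lam_ar i j) G \<and> (\<exists>P. correct_apf G P)"

definition abs_prefix :: "('v, lam_sym) tgraph \<Rightarrow> 'v \<Rightarrow> 'v list" where
  "abs_prefix G = (THE P. correct_apf G P)"

lemma correct_apf_dom: "correct_apf G P \<Longrightarrow> P \<in> verts G \<rightarrow>\<^sub>E lists (verts G)"
  and correct_apf_root: "correct_apf G P \<Longrightarrow> P (root G) = []"
  unfolding correct_apf_def by (elim conjE, assumption)+

lemma correct_apf_edge_unique:
  assumes tg: "term_graph (lam_ar i j) G" and j: "j \<le> 2" and i: "i \<le> 1"
    and P: "correct_apf G P" and Q: "correct_apf G Q"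
    and e: "edge G w w'" and eq: "P w = Q w"
  shows "P w' = Q w'"
proof -
  obtain k where k: "edge_at G k w w'" using e by (auto simp: edge_def)
  have w: "w \<in> verts G" "w' \<in> verts G" "k < lam_ar i j (lab G w)"
    using k tg unfolding edge_at_def term_graph_def by (blast, blast, metis)
  have step: "(lab G w = App \<longrightarrow> R w' = R w) \<and> (lab G w = Lam \<longrightarrow> R w' = R w @ [w]) \<and>
      (lab G w = Zero \<or> lab G w = Succ \<longrightarrow> R w' = butlast (R w))"
    if R: "correct_apf G R" for R
  proof (cases "lab G w")
    case App
    then have "k \<in> {0, 1}" using w(3) by auto
    moreover have "\<forall>w \<in> verts G. \<forall>k \<in> {0, 1}. \<forall>wk \<in> verts G.
        lab G w = App \<and> edge_at G k w wk \<longrightarrow> R wk = R w"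
      using R unfolding correct_apf_def by (elim conjE) assumption
    ultimately have "R w' = R w" using App k w(1,2) by blast
    then show ?thesis using App by simp
  next
    case Lam
    then have "k = 0" using w(3) by simp
    moreover have "\<forall>w \<in> verts G. \<forall>w0 \<in> verts G.
        lab G w = Lam \<and> edge_at G 0 w w0 \<longrightarrow> R w0 = R w @ [w]"
      using R unfolding correct_apf_def by (elim conjE) assumption
    ultimately have "R w' = R w @ [w]" using Lam k w(1,2) by blast
    then show ?thesis using Lam by simp
  next
    case Zero
    then have "k = 0" using w(3) i by simp
    moreover have "\<forall>w \<in> verts G. \<forall>w0 \<in> verts G.
        lab G w = Zero \<and> edge_at G 0 w w0 \<longrightarrow> lab G w0 = Lam \<and> R w0 @ [w0] = R w"
      using R unfolding correct_apf_def by (elim conjE) assumption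
    ultimately have "R w' @ [w'] = R w" using Zero k w(1,2) by blast
    then have "R w' = butlast (R w)" using butlast_snoc[of "R w'" w'] by simp
    then show ?thesis using Zero by simp
  next
    case Succ
    then have "k = 0 \<or> k = 1" using w(3) j by auto
    moreover have "\<forall>w \<in> verts G. \<forall>w0 \<in> verts G.
        lab G w = Succ \<and> edge_at G 0 w w0 \<longrightarrow> (\<exists>v \<in> verts G. R w0 @ [v] = R w)"
      using R unfolding correct_apf_def by (elim conjE) assumption
    moreover have "\<forall>w \<in> verts G. \<forall>w1 \<in> verts G.
        lab G w = Succ \<and> edge_at G 1 w w1 \<longrightarrow> lab G w1 = Lam \<and> R w1 @ [w1] = R w"
      using R unfolding correct_apf_def by (elim conjE) assumption
    ultimately have "\<exists>v. R w' @ [v] = R w" using Succ k w(1,2) by blast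
    then obtain v where "R w' @ [v] = R w" by blast
    then have "R w' = butlast (R w)" using butlast_snoc[of "R w'" v] by simp
    then show ?thesis using Succ by simp
  qed
  show ?thesis using step[OF P] step[OF Q] eq by (cases "lab G w") simp_all
qed

lemma correct_apf_unique:
  assumes tg: "term_graph (lam_ar i j) G" and ij: "i \<le> 1" "j \<le> 2"
    and P: "correct_apf G P" and Q: "correct_apf G Q"
  shows "P = Q"
proof
  fix v
  show "P v = Q v"
  proof (cases "v \<in> verts G")
    case True
    then have "(edge G)\<^sup>*\<^sup>* (root G) v" using tg by (simp add: term_graph_def)
    then show ?thesis
    proof (induction rule: rtranclp_induct)
      case base
      show ?case by (simp add: correct_apf_root[OF P] correct_apf_root[OF Q])
    next
      case (step w w')
      then show ?case using correct_apf_edge_unique[OF tg ij(2,1) P Q] by blast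
    qed
  next
    case False
    then show ?thesis
      using PiE_arb[OF correct_apf_dom[OF P]] PiE_arb[OF correct_apf_dom[OF Q]] by simp
  qed
qed

lemma correct_apf_abs_prefix:
  assumes "lambda_term_graph i j G" "i \<le> 1" "j \<le> 2"
  shows "correct_apf G (abs_prefix G)"
proof -
  obtain P where P: "correct_apf G P" and tg: "term_graph (lam_ar i j) G"
    using assms(1) by (auto simp: lambda_term_graph_def)
  show ?thesis
    unfolding abs_prefix_def
    by (rule theI[of _ P], rule P) (rule correct_apf_unique[OF tg assms(2,3) _ P])
qed

text \<open>Both properties below are meant for \<open>\<lambda>\<close>-term-graphs, where \<open>abs_prefix\<close> is the unique
  correct abstraction-prefix function. The path \<open>w = ws 0, \<dots>, ws n\<close> is followed by the final
  edge into \<open>v\<close>; values of \<open>ws\<close> beyond \<open>n\<close> are irrelevant.\<close>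

definition eager_scope :: "('v, lam_sym) tgraph \<Rightarrow> bool" where
  "eager_scope G \<longleftrightarrow>
     (\<forall>w \<in> verts G. \<forall>v \<in> verts G. \<forall>p \<in> lists (verts G).
        abs_prefix G w = p @ [v] \<and> lab G w \<noteq> Succ \<longrightarrow>
        (\<exists>(n::nat) ws. ws 0 = w \<and> (\<forall>i<n. edge G (ws i) (ws (Suc i))) \<and> edge_at G 0 (ws n) v \<and>
           lab G (ws n) = Zero \<and>
           (\<forall>i. 1 \<le> i \<and> i < n \<longrightarrow> prefix (p @ [v]) (abs_prefix G (ws i)))))"

definition fully_back_linked :: "('v, lam_sym) tgraph \<Rightarrow> bool" where
  "fully_back_linked G \<longleftrightarrow>
     (\<forall>w \<in> verts G. \<forall>v \<in> verts G. \<forall>p \<in> lists (verts G).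
        abs_prefix G w = p @ [v] \<longrightarrow>
        (\<exists>(n::nat) ws. ws 0 = w \<and> (\<forall>i<n. edge G (ws i) (ws (Suc i))) \<and> edge G (ws n) v \<and>
           (\<forall>i\<le>n. prefix (p @ [v]) (abs_prefix G (ws i)))))"

end

theory Submission
  imports Defs
begin

text \<open>A backlink of \<open>G\<close> tells how the binder at the end of an abstraction prefix is found by
  following edges. Suppose \<open>h w1 = h w2\<close> and \<open>P w1 = p @ [v]\<close>. A path inside the scope of \<open>v\<close> from
  \<open>w1\<close> to a vertex with an edge to \<open>v\<close> can be followed in lockstep from \<open>w2\<close>, because \<open>h\<close> preserves
  labels and arguments. Labels determine how the length of the prefix changes along an edge, so the
  second path stays inside the scope of the last binder \<open>v2\<close> of \<open>P w2\<close> and leads back to it; hence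
  \<open>h v = h v2\<close>. Induction on the length of the prefix yields \<open>map h (P w1) = map h (P w2)\<close>, so that
  \<open>P\<close> descends along \<open>h\<close>, and the paths required in the image are the images of paths of \<open>G\<close>. An
  eager-scope graph is fully back-linked, so this covers both cases.\<close>

section \<open>Abstraction prefixes along the edges of one graph\<close>

locale apf_graph =
  fixes G :: "('v, lam_sym) tgraph" and P :: "'v \<Rightarrow> 'v list"
  assumes tg: "term_graph (lam_ar 1 2) G" and apf: "correct_apf G P"
begin

lemma length_args: "w \<in> verts G \<Longrightarrow> length (args G w) = lam_ar 1 2 (lab G w)"
  using tg by (simp add: term_graph_def)

lemma nth_args_verts: "w \<in> verts G \<Longrightarrow> k < length (args G w) \<Longrightarrow> args G w ! k \<in> verts G"
  using tg unfolding term_graph_def by (metis PiE in_listsD nth_mem Pi_iff)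

lemma apf_lists: "w \<in> verts G \<Longrightarrow> P w \<in> lists (verts G)"
  using correct_apf_dom[OF apf] by blast

lemma apf_Lam: "edge_at G 0 w w' \<Longrightarrow> lab G w = Lam \<Longrightarrow> P w' = P w @ [w]"
  using apf unfolding correct_apf_def edge_at_def by blast

lemma apf_App: "edge_at G k w w' \<Longrightarrow> k \<in> {0, 1} \<Longrightarrow> lab G w = App \<Longrightarrow> P w' = P w"
  using apf unfolding correct_apf_def by (elim conjE) (blast dest: edge_at_def[THEN iffD1])

lemma apf_Zero: "edge_at G 0 w w' \<Longrightarrow> lab G w = Zero \<Longrightarrow> lab G w' = Lam \<and> P w' @ [w'] = P w"
  using apf unfolding correct_apf_def edge_at_def by blast

lemma apf_Succ_0: "edge_at G 0 w w' \<Longrightarrow> lab G w = Succ \<Longrightarrow> \<exists>v \<in> verts G. P w' @ [v] = P w"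
  using apf unfolding correct_apf_def edge_at_def by blast

lemma apf_Succ_1: "edge_at G 1 w w' \<Longrightarrow> lab G w = Succ \<Longrightarrow> lab G w' = Lam \<and> P w' @ [w'] = P w"
  using apf unfolding correct_apf_def edge_at_def by blast

text \<open>The position of the edge does not matter: the clauses for \<open>Zero\<close> and for
  both edges of \<open>Succ\<close> all have the form \<open>P w' @ [v] = P w\<close>. Two paths
  with equal labels can therefore be compared step by step.\<close>

lemma apf_step:
  assumes e: "edge G w w'"
  shows "P w' = (case lab G w of App \<Rightarrow> P w | Lam \<Rightarrow> P w @ [w] | _ \<Rightarrow> butlast (P w))"
proof -
  obtain k where k: "edge_at G k w w'" using e by (auto simp: edge_def)
  then have "k < lam_ar 1 2 (lab G w)" using length_args[of w] by (auto simp: edge_at_def)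
  moreover have snoc: "P w' = butlast (P w)" if "P w' @ [v] = P w" for v
    using that by (metis butlast_snoc)
  ultimately show ?thesis
    using k apf_Lam[of w w'] apf_App[OF k] apf_Zero[of w w'] apf_Succ_0[of w w'] apf_Succ_1[of w w']
    by (cases "lab G w"; cases k) (auto simp: less_Suc_eq numeral_2_eq_2 intro: snoc)
qed

text \<open>Position of the argument that is the binder: the only argument of \<open>Zero\<close>,
  the second one of \<open>Succ\<close>.\<close>

definition back_index :: "'v \<Rightarrow> nat" where
  "back_index w = (if lab G w = Zero then 0 else 1)"

lemma backlink:
  assumes "w \<in> verts G" "lab G w = Zero \<or> lab G w = Succ"
  shows "edge_at G (back_index w) w (args G w ! back_index w)"
    and "P (args G w ! back_index w) @ [args G w ! back_index w] = P w"
proof -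
  show e: "edge_at G (back_index w) w (args G w ! back_index w)"
    using assms length_args nth_args_verts[OF assms(1), of "back_index w"]
    by (auto simp: edge_at_def back_index_def)
  show "P (args G w ! back_index w) @ [args G w ! back_index w] = P w"
    using assms(2) apf_Zero[of w] apf_Succ_1[of w] e by (auto simp: back_index_def)
qed

lemma apf_nonempty: "w \<in> verts G \<Longrightarrow> lab G w = Zero \<or> lab G w = Succ \<Longrightarrow> P w \<noteq> []"
  using backlink(2) by (metis snoc_eq_iff_butlast)

text \<open>Induction along a path from the root: the prefix grows only on leaving an abstraction
  \<open>w\<close>, where the new entry is \<open>w\<close> and what precedes it is exactly
  \<open>P w\<close>. After any other edge it is a prefix of \<open>P w\<close>.\<close>

lemma apf_binder:
  assumes "w \<in> verts G" "prefix (p @ [v]) (P w)"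
  shows "P v = p"
proof -
  have "(edge G)\<^sup>*\<^sup>* (root G) w" using tg assms(1) by (simp add: term_graph_def)
  then show ?thesis using assms(2)
  proof (induction rule: rtranclp_induct)
    case base
    then show ?case by (simp add: correct_apf_root[OF apf])
  next
    case (step w w')
    have "prefix (butlast (P w)) (P w)" by (simp add: prefixeq_butlast)
    then show ?case using step.IH step.prems apf_step[OF step.hyps(2)]
      by (auto split: lam_sym.splits intro: prefix_order.trans)
  qed
qed

text \<open>As \<open>P v = p\<close> is shorter than \<open>P u\<close>, the edge shortens the
  prefix, and it can drop only one entry. The edge may be the first one of a \<open>Succ\<close>
  vertex, hence the separate claim that the back-link also ends in \<open>v\<close>.\<close>

lemma apf_scope_exit:
  assumes e: "edge G u v" and pre: "prefix (p @ [v]) (P u)"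
  shows "lab G u = Zero \<or> lab G u = Succ" "P u = p @ [v]" "args G u ! back_index u = v"
proof -
  have u: "u \<in> verts G" using e by (auto simp: edge_def edge_at_def)
  have Pv: "P v = p" by (rule apf_binder[OF u pre])
  have len: "length p < length (P u)" using prefix_length_le[OF pre] by simp
  show l: "lab G u = Zero \<or> lab G u = Succ"
    using apf_step[OF e] Pv len by (cases "lab G u") auto
  then have "butlast (P u) = p" using apf_step[OF e] Pv by auto
  then have "length (P u) = Suc (length p)" using len by auto
  then show Pu: "P u = p @ [v]"
    using pre by (metis length_append_singleton not_equal_is_parallel parallelD1 prefix_order.order_refl)
  then show "args G u ! back_index u = v" using backlink(2)[OF u l] by simp
qed

lemma abs_prefix_eq: "abs_prefix G = P"
  using correct_apf_unique[OF tg] apf correct_apf_abs_prefix[of 1 2 G] tg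
  unfolding lambda_term_graph_def by force

section \<open>Paths inside the scope of a binder\<close>

definition scope_edge :: "'v list \<Rightarrow> 'v \<Rightarrow> 'v \<Rightarrow> bool" where
  "scope_edge q x y \<longleftrightarrow> edge G x y \<and> prefix q (P x) \<and> prefix q (P y)"

text \<open>Recasts the indexed path as a reflexive-transitive closure, ready for rule
  induction.\<close>

lemma fully_back_linked_scope_path:
  assumes fbl: "fully_back_linked G" and w: "w \<in> verts G" and Pw: "P w = p @ [v]"
  obtains u where "(scope_edge (p @ [v]))\<^sup>*\<^sup>* w u" "edge G u v" "prefix (p @ [v]) (P u)"
proof -
  have "v \<in> verts G" "p \<in> lists (verts G)" using apf_lists[OF w] Pw by auto
  then obtain n ws where ws: "ws 0 = w" "\<forall>i<n. edge G (ws i) (ws (Suc i))" "edge G (ws n) v"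
      "\<forall>i\<le>n. prefix (p @ [v]) (P (ws i))"
    using fbl w Pw unfolding fully_back_linked_def abs_prefix_eq by blast
  have "(scope_edge (p @ [v]))\<^sup>*\<^sup>* w (ws i)" if "i \<le> n" for i
    using that
  proof (induction i)
    case (Suc i)
    then have "scope_edge (p @ [v]) (ws i) (ws (Suc i))" using ws by (simp add: scope_edge_def)
    then show ?case using Suc by (meson Suc_leD rtranclp.rtrancl_into_rtrancl)
  qed (simp add: ws)
  then show ?thesis using that ws by blast
qed

lemma eager_scope_imp_fully_back_linked:
  assumes es: "eager_scope G"
  shows "fully_back_linked G"
  unfolding fully_back_linked_def abs_prefix_eq
proof (intro ballI impI)
  fix w v p
  assume w: "w \<in> verts G" and v: "v \<in> verts G" and p: "p \<in> lists (verts G)" and Pw: "P w = p @ [v]"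
  show "\<exists>(n::nat) ws. ws 0 = w \<and> (\<forall>i<n. edge G (ws i) (ws (Suc i))) \<and> edge G (ws n) v \<and>
           (\<forall>i\<le>n. prefix (p @ [v]) (P (ws i)))"
  proof (cases "lab G w = Succ")
    case True
    \<comment> \<open>Eager scope says nothing about \<open>Succ\<close> vertices, but their own
      back-link already leads to \<open>v\<close>.\<close>
    then have "edge G w v" using backlink[OF w] Pw by (auto simp: edge_def)
    then show ?thesis using Pw by (intro exI[of _ 0] exI[of _ "\<lambda>_. w"]) simp
  next
    case False
    then obtain n ws where ws: "ws 0 = w" "\<forall>i<n. edge G (ws i) (ws (Suc i))" "edge_at G 0 (ws n) v"
        "lab G (ws n) = Zero" "\<forall>i. 1 \<le> i \<and> i < n \<longrightarrow> prefix (p @ [v]) (P (ws i))"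
      using es w v p Pw unfolding eager_scope_def abs_prefix_eq by blast
    \<comment> \<open>Eager scope gives the prefix condition only strictly between the ends. At
      index \<open>n\<close> the \<open>Zero\<close> clause supplies it; at index 0 it is the
      assumption on \<open>P w\<close>.\<close>
    have "P v = p" using apf_binder[OF w] Pw by simp
    then have "P (ws n) = p @ [v]" using apf_Zero[OF ws(3,4)] by simp
    then have "prefix (p @ [v]) (P (ws i))" if "i \<le> n" for i
      using that ws(1,5) Pw by (cases "i = 0"; cases "i = n") auto
    then show ?thesis using ws by (intro exI[of _ n] exI[of _ ws]) (auto simp: edge_def)
  qed
qed

end

section \<open>Lifting edges and vertices along a homomorphism\<close>

locale apf_graph_hom = apf_graph G P for G :: "('v, lam_sym) tgraph" and P +
  fixes G' :: "('w, lam_sym) tgraph" and h :: "'v \<Rightarrow> 'w"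
  assumes tg': "term_graph (lam_ar 1 2) G'" and hom: "tg_hom h G G'"
begin

lemma hom_verts: "w \<in> verts G \<Longrightarrow> h w \<in> verts G'"
  and hom_root: "h (root G) = root G'"
  and hom_lab: "w \<in> verts G \<Longrightarrow> lab G' (h w) = lab G w"
  and hom_args: "w \<in> verts G \<Longrightarrow> args G' (h w) = map h (args G w)"
  using hom by (auto simp: tg_hom_def)

lemma hom_edge_at: "edge_at G k x y \<Longrightarrow> edge_at G' k (h x) (h y)"
  by (auto simp: edge_at_def hom_verts hom_args)

lemma hom_edge: "edge G x y \<Longrightarrow> edge G' (h x) (h y)"
  using hom_edge_at by (auto simp: edge_def)

lemma hom_edge_at_lift:
  assumes "x \<in> verts G" "edge_at G' k (h x) y'"
  obtains y where "edge_at G k x y" "h y = y'"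
  using assms nth_args_verts[OF assms(1), of k] by (auto simp: edge_at_def hom_args)

text \<open>Every vertex of \<open>G'\<close> is reachable from the root, which has a preimage, and
  edges lift one at a time.\<close>

lemma hom_surj:
  assumes "x' \<in> verts G'"
  obtains x where "x \<in> verts G" "h x = x'"
proof -
  have "(edge G')\<^sup>*\<^sup>* (root G') x'" using tg' assms by (simp add: term_graph_def)
  then have "\<exists>x \<in> verts G. h x = x'"
  proof (induction rule: rtranclp_induct)
    case base
    then show ?case using tg hom_root by (auto simp: term_graph_def)
  next
    case (step y' z')
    then obtain y k where "y \<in> verts G" "h y = y'" "edge_at G' k y' z'" by (auto simp: edge_def)
    then show ?case using hom_edge_at_lift[of y k z'] by (metis edge_at_def)
  qed
  then show ?thesis using that by blast
qed

section \<open>Identified vertices have identified prefixes\<close>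

text \<open>The equation says, without subtraction, that both prefixes have changed in length by the
  same amount. As the first never gets shorter than \<open>P w1\<close>, the second never gets
  shorter than \<open>P w2\<close>.\<close>

lemma scope_path_lockstep:
  assumes path: "(scope_edge (P w1))\<^sup>*\<^sup>* w1 u1"
    and w: "w1 \<in> verts G" "w2 \<in> verts G" and hw: "h w1 = h w2"
  shows "\<exists>u2 \<in> verts G. u1 \<in> verts G \<and> h u1 = h u2 \<and> prefix (P w2) (P u2) \<and>
    length (P u1) + length (P w2) = length (P u2) + length (P w1)"
  using path
proof (induction rule: rtranclp_induct)
  case base
  then show ?case using w hw by auto
next
  case (step u1 y1)
  then obtain u2 where u: "u2 \<in> verts G" "u1 \<in> verts G" "h u1 = h u2" "prefix (P w2) (P u2)"
    "length (P u1) + length (P w2) = length (P u2) + length (P w1)" by blast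
  have e1: "edge G u1 y1" and pre: "prefix (P w1) (P y1)"
    using step.hyps(2) by (auto simp: scope_edge_def)
  obtain k where k: "edge_at G k u1 y1" using e1 by (auto simp: edge_def)
  then obtain y2 where y2: "edge_at G k u2 y2" "h y2 = h y1"
    using hom_edge_at_lift[OF u(1), of k "h y1"] hom_edge_at[OF k] u(3) by auto
  have e2: "edge G u2 y2" using y2 by (auto simp: edge_def)
  have l: "lab G u1 = lab G u2" using u hom_lab by metis
  \<comment> \<open>Equal labels force equal changes of length; for \<open>Zero\<close> and
    \<open>Succ\<close> this relies on nonempty prefixes, since \<open>butlast []\<close> does not
    shrink.\<close>
  have len: "length (P y1) + length (P w2) = length (P y2) + length (P w1)"
    using apf_step[OF e1] apf_step[OF e2] u(5) l apf_nonempty[OF u(1)] apf_nonempty[OF u(2)]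
    by (cases "lab G u2") (auto simp: neq_Nil_conv)
  then have le: "length (P w2) \<le> length (P y2)" using prefix_length_le[OF pre] by simp
  \<comment> \<open>If \<open>P y2\<close> does not extend \<open>P u2\<close>, it is a prefix of
    it, as is \<open>P w2\<close>, and the length bound orders the two.\<close>
  have "prefix (P w2) (P y2)"
  proof (cases "prefix (P u2) (P y2)")
    case True
    then show ?thesis using u(4) by (rule prefix_order.trans[rotated])
  next
    case False
    then have "prefix (P y2) (P u2)"
      using apf_step[OF e2] by (auto split: lam_sym.splits simp: prefixeq_butlast)
    then show ?thesis using u(4) le prefix_length_prefix by blast
  qed
  then show ?case using y2 k len by (intro bexI[of _ y2]) (auto simp: edge_at_def)
qed

lemma last_binder_identified:
  assumes fbl: "fully_back_linked G" and w: "w1 \<in> verts G" "w2 \<in> verts G" and hw: "h w1 = h w2"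
    and Pw1: "P w1 = p1 @ [v1]"
  obtains p2 v2 where "P w2 = p2 @ [v2]" "h v1 = h v2"
proof -
  obtain u1 where path: "(scope_edge (P w1))\<^sup>*\<^sup>* w1 u1" and e: "edge G u1 v1"
    and pre: "prefix (p1 @ [v1]) (P u1)"
    using fully_back_linked_scope_path[OF fbl w(1) Pw1] Pw1 by auto
  note exit = apf_scope_exit[OF e pre]
  obtain u2 where u: "u2 \<in> verts G" "u1 \<in> verts G" "h u1 = h u2" "prefix (P w2) (P u2)"
    "length (P u1) + length (P w2) = length (P u2) + length (P w1)"
    using scope_path_lockstep[OF path w hw] by blast
  have l: "lab G u1 = lab G u2" using u hom_lab by metis
  then have l2: "lab G u2 = Zero \<or> lab G u2 = Succ" using exit(1) by simp
  \<comment> \<open>Since \<open>P u1 = P w1\<close>, the length equation makes \<open>P w2\<close>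
    as long as \<open>P u2\<close>, of which it is a prefix.\<close>
  have "P w2 = P u2"
    using u(4,5) exit(2) Pw1 by (auto simp: prefix_def)
  moreover have "back_index u1 = back_index u2" using l by (simp add: back_index_def)
  then have "h (args G u1 ! back_index u1) = h (args G u2 ! back_index u2)"
    using backlink(1)[OF u(2) exit(1)] backlink(1)[OF u(1) l2] hom_args[OF u(1)] hom_args[OF u(2)] u(3)
    by (metis edge_at_def nth_map)
  ultimately show ?thesis using that backlink(2)[OF u(1) l2] exit(3) by metis
qed

text \<open>By \<open>apf_binder\<close>, the rest of each prefix is the prefix of its last binder.
  These binders have equal images, so the induction hypothesis applies to them.\<close>

lemma apf_image_unique:
  assumes fbl: "fully_back_linked G"
  shows "w1 \<in> verts G \<Longrightarrow> w2 \<in> verts G \<Longrightarrow> h w1 = h w2 \<Longrightarrow> map h (P w1) = map h (P w2)"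
proof (induction "length (P w1)" arbitrary: w1 w2 rule: less_induct)
  case less
  show ?case
  proof (cases "P w1" rule: rev_cases)
    case Nil
    \<comment> \<open>With the two vertices swapped, a last binder of \<open>P w2\<close> would
      force one in \<open>P w1\<close>.\<close>
    have "P w2 = []"
    proof (rule ccontr)
      assume "P w2 \<noteq> []"
      then obtain p v where "P w2 = p @ [v]" by (metis rev_exhaust)
      then show False
        using last_binder_identified[OF fbl less.prems(2,1) less.prems(3)[symmetric]] Nil by auto
    qed
    then show ?thesis using Nil by simp
  next
    case (snoc p1 v1)
    obtain p2 v2 where v2: "P w2 = p2 @ [v2]" "h v1 = h v2"
      using last_binder_identified[OF fbl less.prems snoc] by blast
    have "P v1 = p1" "P v2 = p2"
      using apf_binder[OF less.prems(1)] apf_binder[OF less.prems(2)] snoc v2 by auto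
    moreover have "v1 \<in> verts G" "v2 \<in> verts G"
      using apf_lists[OF less.prems(1)] apf_lists[OF less.prems(2)] snoc v2 by auto
    ultimately have "map h p1 = map h p2" using less.hyps[of v1 v2] v2 snoc by auto
    then show ?thesis using snoc v2 by simp
  qed
qed

section \<open>The abstraction-prefix function of the image\<close>

text \<open>\<open>inv_into\<close> picks some preimage; full back-linking makes the choice
  irrelevant. \<open>restrict\<close> gives the extensionality that \<open>correct_apf\<close>
  demands.\<close>

definition image_apf :: "'w \<Rightarrow> 'w list" where
  "image_apf = restrict (\<lambda>x. map h (P (inv_into (verts G) h x))) (verts G')"

lemma image_apf_hom:
  assumes "fully_back_linked G" "w \<in> verts G"
  shows "image_apf (h w) = map h (P w)"
  using assms hom_verts[OF assms(2)]
  by (auto simp: image_apf_def inv_into_into f_inv_into_f intro!: apf_image_unique)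

lemma correct_image_apf:
  assumes fbl: "fully_back_linked G"
  shows "correct_apf G' image_apf"
  unfolding correct_apf_def
proof (intro conjI ballI impI; (elim conjE)?)
  note im = image_apf_hom[OF fbl]
  show "image_apf \<in> verts G' \<rightarrow>\<^sub>E lists (verts G')"
  proof (rule PiE_I)
    fix x assume "x \<in> verts G'"
    then obtain w where w: "w \<in> verts G" "h w = x" using hom_surj by blast
    then show "image_apf x \<in> lists (verts G')"
      using im[OF w(1)] apf_lists[OF w(1)] hom_verts by (auto simp: in_lists_conv_set)
  qed (simp add: image_apf_def)
  show "image_apf (root G') = []"
    using im[of "root G"] tg hom_root correct_apf_root[OF apf] by (simp add: term_graph_def)
  \<comment> \<open>Each edge of \<open>G'\<close> is the image of an edge of \<open>G\<close> with
    the same position and labels, so each clause for \<open>G'\<close> is the image of the clause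
    for \<open>G\<close>.\<close>
  have lift: "\<exists>w y. edge_at G k w y \<and> h w = x' \<and> h y = y' \<and> lab G w = lab G' x' \<and>
      lab G y = lab G' y' \<and> y \<in> verts G \<and>
      image_apf x' = map h (P w) \<and> image_apf y' = map h (P y)"
    if e: "edge_at G' k x' y'" for k x' y'
  proof -
    obtain w where w: "w \<in> verts G" "h w = x'" using e hom_surj[of x'] unfolding edge_at_def by blast
    then obtain y where y: "edge_at G k w y" "h y = y'" using hom_edge_at_lift e by blast
    then have "y \<in> verts G" by (simp add: edge_at_def)
    then show ?thesis using w y im hom_lab by metis
  qed
  show "image_apf w' = image_apf w @ [w]" if "lab G' w = Lam" "edge_at G' 0 w w'" for w w'
    using lift[OF that(2)] that(1) apf_Lam by fastforce
  show "image_apf w' = image_apf w" if "k \<in> {0, 1}" "lab G' w = App" "edge_at G' k w w'" for w k w'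
    using lift[OF that(3)] that(1,2) apf_App by metis
  show "image_apf w \<noteq> []" if "w \<in> verts G'" "lab G' w = Zero" for w
    using hom_surj[OF that(1)] that(2) im hom_lab apf_nonempty by (metis Nil_is_map_conv)
  show "lab G' w' = Lam" "image_apf w' @ [w'] = image_apf w"
    if l: "lab G' w = Zero" and e: "edge_at G' 0 w w'" for w w'
  proof -
    obtain x y where xy: "edge_at G 0 x y" "lab G x = Zero" "h y = w'" "lab G y = lab G' w'"
      "image_apf w = map h (P x)" "image_apf w' = map h (P y)"
      using lift[OF e] l by metis
    then have "lab G y = Lam" "P x = P y @ [y]" using apf_Zero by simp_all
    then show "lab G' w' = Lam" "image_apf w' @ [w'] = image_apf w" using xy by simp_all
  qed
  show "\<exists>v \<in> verts G'. image_apf w' @ [v] = image_apf w"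
    if l: "lab G' w = Succ" and e: "edge_at G' 0 w w'" for w w'
  proof -
    obtain x y where xy: "edge_at G 0 x y" "lab G x = Succ"
      "image_apf w = map h (P x)" "image_apf w' = map h (P y)"
      using lift[OF e] l by metis
    then obtain v where "v \<in> verts G" "P x = P y @ [v]" using apf_Succ_0 by metis
    then show ?thesis using xy hom_verts by (intro bexI[of _ "h v"]) auto
  qed
  show "lab G' w' = Lam" "image_apf w' @ [w'] = image_apf w"
    if l: "lab G' w = Succ" and e: "edge_at G' 1 w w'" for w w'
  proof -
    obtain x y where xy: "edge_at G 1 x y" "lab G x = Succ" "h y = w'" "lab G y = lab G' w'"
      "image_apf w = map h (P x)" "image_apf w' = map h (P y)"
      using lift[OF e] l by metis
    then have "lab G y = Lam" "P x = P y @ [y]" using apf_Succ_1 by simp_all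
    then show "lab G' w' = Lam" "image_apf w' @ [w'] = image_apf w" using xy by simp_all
  qed
qed

lemma hom_image_lambda_term_graph: "fully_back_linked G \<Longrightarrow> lambda_term_graph 1 2 G'"
  using correct_image_apf tg' by (auto simp: lambda_term_graph_def)

text \<open>Uniqueness of the abstraction-prefix function, applied in \<open>G'\<close>, identifies
  it with \<open>image_apf\<close>.\<close>

lemma abs_prefix_hom:
  assumes "fully_back_linked G" "w \<in> verts G"
  shows "abs_prefix G' (h w) = map h (P w)"
  using apf_graph.abs_prefix_eq[of G' image_apf] correct_image_apf tg' image_apf_hom assms
  by (simp add: apf_graph_def)

lemma abs_prefix_hom_snocE:
  assumes fbl: "fully_back_linked G" and "w' \<in> verts G'" "abs_prefix G' w' = p' @ [v']"
  obtains w p v where "w \<in> verts G" "h w = w'" "P w = p @ [v]" "map h p = p'" "h v = v'"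
    "v \<in> verts G" "p \<in> lists (verts G)"
proof -
  obtain w where w: "w \<in> verts G" "h w = w'" using hom_surj assms by blast
  then have "map h (P w) = p' @ [v']" using abs_prefix_hom assms by metis
  then obtain p v where "P w = p @ [v]" "map h p = p'" "h v = v'"
    by (auto simp: map_eq_append_conv)
  then show ?thesis using that w apf_lists[OF w(1)] by auto
qed

lemma abs_prefix_hom_prefix:
  assumes "fully_back_linked G" "w \<in> verts G" "prefix q (P w)"
  shows "prefix (map h q) (abs_prefix G' (h w))"
  using assms abs_prefix_hom map_mono_prefix by metis

section \<open>Transfer of the two scope properties\<close>

lemma hom_image_fully_back_linked:
  assumes fbl: "fully_back_linked G"
  shows "fully_back_linked G'"
  unfolding fully_back_linked_def
proof (intro ballI impI)
  fix w' v' p'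
  assume w': "w' \<in> verts G'" and Pw': "abs_prefix G' w' = p' @ [v']"
  obtain w p v where w: "w \<in> verts G" "h w = w'" "P w = p @ [v]" "map h p = p'" "h v = v'"
    "v \<in> verts G" "p \<in> lists (verts G)"
    using abs_prefix_hom_snocE[OF fbl w' Pw'] by metis
  then obtain n ws where ws: "ws 0 = w" "\<forall>i<n. edge G (ws i) (ws (Suc i))" "edge G (ws n) v"
      "\<forall>i\<le>n. prefix (p @ [v]) (P (ws i))"
    using fbl unfolding fully_back_linked_def abs_prefix_eq by blast
  \<comment> \<open>Index \<open>n\<close> is treated apart: \<open>ws n\<close> is a vertex as the
    source of the final edge into \<open>v\<close>.\<close>
  have "ws i \<in> verts G" if "i \<le> n" for i
    using that ws(2,3) by (cases "i = n") (auto simp: edge_def edge_at_def)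
  then have "prefix (p' @ [v']) (abs_prefix G' (h (ws i)))" if "i \<le> n" for i
    using abs_prefix_hom_prefix[OF fbl, of "ws i" "p @ [v]"] that ws(4) w by simp
  then show "\<exists>(n::nat) ws. ws 0 = w' \<and> (\<forall>i<n. edge G' (ws i) (ws (Suc i))) \<and> edge G' (ws n) v' \<and>
           (\<forall>i\<le>n. prefix (p' @ [v']) (abs_prefix G' (ws i)))"
    using ws w hom_edge by (intro exI[of _ n] exI[of _ "h \<circ> ws"]) auto
qed

lemma hom_image_eager_scope:
  assumes es: "eager_scope G"
  shows "eager_scope G'"
  unfolding eager_scope_def
proof (intro ballI impI; elim conjE)
  \<comment> \<open>Full back-linking is what lets the prefixes in \<open>G'\<close> be read off
    from those in \<open>G\<close>.\<close>
  note fbl = eager_scope_imp_fully_back_linked[OF es]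
  fix w' v' p'
  assume w': "w' \<in> verts G'" and Pw': "abs_prefix G' w' = p' @ [v']" and l: "lab G' w' \<noteq> Succ"
  obtain w p v where w: "w \<in> verts G" "h w = w'" "P w = p @ [v]" "map h p = p'" "h v = v'"
    "v \<in> verts G" "p \<in> lists (verts G)"
    using abs_prefix_hom_snocE[OF fbl w' Pw'] by metis
  then have "lab G w \<noteq> Succ" using l hom_lab by metis
  then obtain n ws where ws: "ws 0 = w" "\<forall>i<n. edge G (ws i) (ws (Suc i))" "edge_at G 0 (ws n) v"
      "lab G (ws n) = Zero" "\<forall>i. 1 \<le> i \<and> i < n \<longrightarrow> prefix (p @ [v]) (P (ws i))"
    using es w unfolding eager_scope_def abs_prefix_eq by blast
  have V: "ws i \<in> verts G" if "i \<le> n" for i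
    using that ws(2,3) by (cases "i = n") (auto simp: edge_def edge_at_def)
  then have "prefix (p' @ [v']) (abs_prefix G' (h (ws i)))" if "1 \<le> i" "i < n" for i
    using abs_prefix_hom_prefix[OF fbl, of "ws i" "p @ [v]"] that ws(5) w by simp
  then show "\<exists>(n::nat) ws. ws 0 = w' \<and> (\<forall>i<n. edge G' (ws i) (ws (Suc i))) \<and>
      edge_at G' 0 (ws n) v' \<and> lab G' (ws n) = Zero \<and>
      (\<forall>i. 1 \<le> i \<and> i < n \<longrightarrow> prefix (p' @ [v']) (abs_prefix G' (ws i)))"
    using ws w V[of n] hom_edge hom_edge_at hom_lab
    by (intro exI[of _ n] exI[of _ "h \<circ> ws"]) auto
qed

end

theorem theorem7p8:
  fixes G :: "('v, lam_sym) tgraph" and G' :: "('w, lam_sym) tgraph" and h :: "'v \<Rightarrow> 'w"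
  assumes "lambda_term_graph 1 2 G"
    and "term_graph (lam_ar 1 2) G'"
    and "tg_hom h G G'"
  shows "(fully_back_linked G \<longrightarrow> lambda_term_graph 1 2 G' \<and> fully_back_linked G') \<and>
         (eager_scope G \<longrightarrow> lambda_term_graph 1 2 G' \<and> eager_scope G')"
proof -
  obtain P where "term_graph (lam_ar 1 2) G" "correct_apf G P"
    using assms(1) by (auto simp: lambda_term_graph_def)
  then interpret apf_graph_hom G P G' h
    using assms(2,3) by unfold_locales
  \<comment> \<open>In the eager-scope case, \<open>G'\<close> is a \<lambda>-term-graph because
    \<open>G\<close> is then fully back-linked.\<close>
  show ?thesis
    using hom_image_lambda_term_graph hom_image_fully_back_linked hom_image_eager_scope
      eager_scope_imp_fully_back_linked by blast
qed

end
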